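(* Let $n\ge1$ and let $P\subseteq \mathbb{Z}^{n}_{\geq 0}$ be a polymatroid. Then (i) the sequence $[y^{0}]X_{P}(y),[y^{1}]X_{P}(y),\ldots,[y^{r_{2}(P)-1}]X_{P}(y)$ is unimodal; (ii) the sequence $[x^{0}]I_{P}(x),[x^{1}]I_{P}(x),\ldots,[x^{r'_{2}(P)-1}]I_{P}(x)$ is unimodal.
   Context: A rank function on $[n]$ is $f:2^{[n]}\to\mathbb{Z}_{\ge0}$ with $f(\emptyset)=0$, monotone, and submodular. The polymatroid with rank function $f$ is $P=\{\mathbf a\in\mathbb{Z}^n_{\ge 0}:\ \sum_{i\in I}a_i\le f(I)\ \forall I\subseteq[n],\ \sum_{i\in[n]}a_i=f([n])\}$. With $\mathbf e_1,\dots,\mathbf e_n$ the standard basis, for $\mathbf a\in P$ an index $i$ is internally active if $\mathbf a-\mathbf e_i+\mathbf e_j\notin P$ for all $j<i$, and externally active if $\mathbf a+\mathbf e_i-\mathbf e_j\notin P$ for all $j<i$; $\mathrm{Int}(\mathbf a),\mathrm{Ext}(\mathbf a)$ denote these sets. $I_P(x)=\sum_{\mathbf a\in P}x^{n-|\mathrm{Int}(\mathbf a)|}$, $X_P(y)=\sum_{\mathbf a\in P}y^{n-|\mathrm{Ext}(\mathbf a)|}$; $[y^i]p$ is the coefficient of $y^i$. $r_{2}(P)=\min\{n-|F|:\ F\subseteq [n],\ f(F)\leq f([n])-2\}$ and $r'_{2}(P)=\min\{|F|:\ F\subseteq [n],\ \sum_{i'\in F}f(\{i'\})-f(F)\geq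 2\}$. A real sequence $a_0,\dots,a_m$ is unimodal if there is an integer $k$ with $a_i\le a_{i+1}$ for $i<k$ and $a_i\ge a_{i+1}$ for $i>k$. *)

theory Defs
  imports "HOL-Computational_Algebra.Polynomial" "HOL-Library.Extended_Nat"
    "HOL-Library.Function_Algebras"
begin

text \<open>The ground set \<open>[n]\<close> is \<open>{1..n}\<close>; only the values of \<open>f\<close> on its subsets matter.\<close>

definition rank_function :: "nat \<Rightarrow> (nat set \<Rightarrow> nat) \<Rightarrow> bool" where
  "rank_function n f \<longleftrightarrow>
     f {} = 0 \<and>
     (\<forall>I J. I \<subseteq> J \<longrightarrow> J \<subseteq> {1..n} \<longrightarrow> f I \<le> f J) \<and>
     (\<forall>I J. I \<subseteq> {1..n} \<longrightarrow> J \<subseteq> {1..n} \<longrightarrow> f (I \<union> J) + f (I \<inter> J) \<le> f I + f J)"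

text \<open>An integer vector of length \<open>n\<close> is a function that vanishes outside \<open>{1..n}\<close>, so that
  equality of vectors is equality of functions.\<close>

definition polymatroid :: "nat \<Rightarrow> (nat set \<Rightarrow> nat) \<Rightarrow> (nat \<Rightarrow> int) set" where
  "polymatroid n f =
     {a. (\<forall>i\<in>{1..n}. 0 \<le> a i) \<and> (\<forall>i. i \<notin> {1..n} \<longrightarrow> a i = 0) \<and>
         (\<forall>I. I \<subseteq> {1..n} \<longrightarrow> (\<Sum>i\<in>I. a i) \<le> int (f I)) \<and>
         (\<Sum>i\<in>{1..n}. a i) = int (f {1..n})}"

definition std_basis :: "nat \<Rightarrow> nat \<Rightarrow> int" where
  "std_basis i = (\<lambda>j. if j = i then 1 else 0)"

definition Int_act :: "nat \<Rightarrow> (nat \<Rightarrow> int) set \<Rightarrow> (nat \<Rightarrow> int) \<Rightarrow> nat set" where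
  "Int_act n P a =
     {i \<in> {1..n}. \<forall>j\<in>{1..n}. j < i \<longrightarrow> a - std_basis i + std_basis j \<notin> P}"

definition Ext_act :: "nat \<Rightarrow> (nat \<Rightarrow> int) set \<Rightarrow> (nat \<Rightarrow> int) \<Rightarrow> nat set" where
  "Ext_act n P a =
     {i \<in> {1..n}. \<forall>j\<in>{1..n}. j < i \<longrightarrow> a + std_basis i - std_basis j \<notin> P}"

definition interior_poly :: "nat \<Rightarrow> (nat \<Rightarrow> int) set \<Rightarrow> int poly" where
  "interior_poly n P = (\<Sum>a\<in>P. monom 1 (n - card (Int_act n P a)))"

definition exterior_poly :: "nat \<Rightarrow> (nat \<Rightarrow> int) set \<Rightarrow> int poly" where
  "exterior_poly n P = (\<Sum>a\<in>P. monom 1 (n - card (Ext_act n P a)))"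

text \<open>These sums are over a finite set:\<close>

lemma finite_polymatroid: "finite (polymatroid n f)"
proof (rule finite_subset)
  let ?B = "{a. \<forall>i. (i \<in> {1..n} \<longrightarrow> a i \<in> {0..int (Max ((\<lambda>i. f {i}) ` {1..n}))})
    \<and> (i \<notin> {1..n} \<longrightarrow> a i = (0::int))}"
  show "finite ?B"
    by (rule finite_set_of_finite_funs) auto
  show "polymatroid n f \<subseteq> ?B"
  proof (clarsimp simp: polymatroid_def)
    fix a :: "nat \<Rightarrow> int" and i
    assume sub: "\<forall>I. I \<subseteq> {Suc 0..n} \<longrightarrow> sum a I \<le> int (f I)" and i: "Suc 0 \<le> i" "i \<le> n"
    have "sum a {i} \<le> int (f {i})"
      using sub i by (intro sub[rule_format]) auto
    moreover have "f {i} \<le> Max ((\<lambda>i. f {i}) ` {Suc 0..n})"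
      using i by (intro Max_ge) auto
    ultimately show "a i \<le> int (Max ((\<lambda>i. f {i}) ` {Suc 0..n}))"
      by simp
  qed
qed

text \<open>The infima below are minima whenever some set \<open>F\<close> qualifies. If none does, they are
  \<open>\<infinity>\<close> (the minimum of the empty set).\<close>

definition r2 :: "nat \<Rightarrow> (nat set \<Rightarrow> nat) \<Rightarrow> enat" where
  "r2 n f = Inf {enat (n - card F) | F. F \<subseteq> {1..n} \<and> int (f F) \<le> int (f {1..n}) - 2}"

definition r2' :: "nat \<Rightarrow> (nat set \<Rightarrow> nat) \<Rightarrow> enat" where
  "r2' n f = Inf {enat (card F) | F. F \<subseteq> {1..n} \<and> (\<Sum>i\<in>F. int (f {i})) - int (f F) \<ge> 2}"

text \<open>Unimodality of the sequence of all \<open>a i\<close> with \<open>i < N\<close>. For \<open>N = \<infinity>\<close> this is the whole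
  sequence.\<close>

definition unimodal_below :: "enat \<Rightarrow> (nat \<Rightarrow> real) \<Rightarrow> bool" where
  "unimodal_below N a \<longleftrightarrow>
     (\<exists>k::int. \<forall>i. enat (Suc i) < N \<longrightarrow>
        (int i < k \<longrightarrow> a i \<le> a (Suc i)) \<and> (int i > k \<longrightarrow> a i \<ge> a (Suc i)))"

end

theory Submission
  imports Defs
begin

text \<open>Write \<open>m = f [n]\<close> and \<open>h S = m - f ([n] - S)\<close>. If \<open>h S \<le> 1\<close> whenever \<open>card S < N\<close>, then
  \<open>(1 - y)^m X\<^sub>P(y)\<close> agrees modulo \<open>y^N\<close> with \<open>1 - \<Sum> y^(card C)\<close>, where \<open>C\<close> ranges over the minimal
  sets with \<open>h C > 0\<close>. This goes by induction on \<open>n\<close>, slicing \<open>P\<close> by its last coordinate \<open>k\<close>: the index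
  \<open>n\<close> is externally active exactly in the slice \<open>k = f {n}\<close>, activity of the other indices may be computed
  inside the slice, and the slices with \<open>k > 0\<close> all give the same truncated right-hand side, so that
  the sum over \<open>k\<close> is geometric. Hence the coefficients of \<open>(1 - y)^m X\<^sub>P(y)\<close> below \<open>r\<^sub>2\<close> change
  sign at most once, from nonnegative to nonpositive. Partial summation preserves this pattern, so it
  passes to \<open>(1 - y) X\<^sub>P(y)\<close>, which is unimodality of \<open>X\<^sub>P\<close>. The interior polynomial is the exterior
  polynomial of the reflection \<open>{c - a | a \<in> P}\<close> with \<open>c\<^sub>i = f {i}\<close>.\<close>

section \<open>Corank and circuits\<close>

lemma rank_functionD:
  assumes "rank_function n f"
  shows "f {} = 0"
    and "\<And>I J. I \<subseteq> J \<Longrightarrow> J \<subseteq> {1..n} \<Longrightarrow> f I \<le> f J"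
    and "\<And>I J. I \<subseteq> {1..n} \<Longrightarrow> J \<subseteq> {1..n} \<Longrightarrow> f (I \<union> J) + f (I \<inter> J) \<le> f I + f J"
  using assms unfolding rank_function_def by auto

lemma rank_insert_le:
  assumes "rank_function n f" "S \<subseteq> {1..n}" "e \<in> {1..n}"
  shows "f (insert e S) \<le> f S + f {e}"
  using rank_functionD(3)[OF assms(1), of "{e}" S] assms(2,3) by simp

lemma polymatroidD:
  assumes "a \<in> polymatroid n f"
  shows "\<And>i. 0 \<le> a i"
    and "\<And>i. i \<notin> {1..n} \<Longrightarrow> a i = 0"
    and "\<And>I. I \<subseteq> {1..n} \<Longrightarrow> sum a I \<le> int (f I)"
    and "sum a {1..n} = int (f {1..n})"
proof -
  show "0 \<le> a i" for i
    using assms unfolding polymatroid_def by (cases "i \<in> {1..n}") auto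
qed (use assms in \<open>auto simp: polymatroid_def\<close>)

text \<open>For the rank function of a matroid this is the nullity of \<open>S\<close> in the dual
  matroid. Monotonicity of a rank function keeps the natural subtraction from truncating.\<close>

definition corank :: "nat \<Rightarrow> (nat set \<Rightarrow> nat) \<Rightarrow> nat set \<Rightarrow> nat" where
  "corank n f S = f {1..n} - f ({1..n} - S)"

text \<open>In the matroid case these are the circuits of the dual matroid, that is, the
  cocircuits.\<close>

definition circuits :: "nat \<Rightarrow> (nat set \<Rightarrow> nat) \<Rightarrow> nat set set" where
  "circuits n f = {C. C \<subseteq> {1..n} \<and> corank n f C > 0 \<and> (\<forall>T. T \<subset> C \<longrightarrow> corank n f T = 0)}"

lemma finite_circuits: "finite (circuits n f)"
  by (rule finite_subset[of _ "Pow {1..n}"]) (auto simp: circuits_def)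

lemma corank_empty [simp]: "corank n f {} = 0"
  by (simp add: corank_def)

lemma corank_mono:
  assumes "rank_function n f" "S \<subseteq> T"
  shows "corank n f S \<le> corank n f T"
  unfolding corank_def
  by (rule diff_le_mono2, rule rank_functionD(2)[OF assms(1)]) (use assms(2) in auto)

lemma corank_supermodular:
  assumes "rank_function n f"
  shows "corank n f S + corank n f T \<le> corank n f (S \<union> T) + corank n f (S \<inter> T)"
proof -
  have "f (({1..n} - S) \<union> ({1..n} - T)) + f (({1..n} - S) \<inter> ({1..n} - T))
      \<le> f ({1..n} - S) + f ({1..n} - T)"
    by (rule rank_functionD(3)[OF assms]) auto
  moreover have "({1..n} - S) \<union> ({1..n} - T) = {1..n} - S \<inter> T"
    "({1..n} - S) \<inter> ({1..n} - T) = {1..n} - (S \<union> T)" by auto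
  moreover have "f ({1..n} - U) \<le> f {1..n}" for U
    by (rule rank_functionD(2)[OF assms]) auto
  note this[of S] this[of T] this[of "S \<union> T"] this[of "S \<inter> T"]
  ultimately show ?thesis unfolding corank_def by simp
qed

lemma corank_insert_le:
  assumes "rank_function n f" "e \<in> {1..n}"
  shows "corank n f (insert e S) \<le> corank n f S + f {e}"
proof -
  have "f ({1..n} - S) \<le> f (insert e ({1..n} - insert e S))"
    by (rule rank_functionD(2)[OF assms(1)]) (use assms(2) in auto)
  also have "\<dots> \<le> f ({1..n} - insert e S) + f {e}"
    by (rule rank_insert_le[OF assms(1)]) (use assms(2) in auto)
  finally show ?thesis unfolding corank_def by simp
qed

section \<open>Slices by the last coordinate\<close>

text \<open>For an admissible \<open>k\<close> this is the rank function of the slice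
  \<open>a (Suc n) = k\<close>, projected to the first \<open>n\<close> coordinates:
  \<open>S\<close> is bounded by its own constraint and by that of
  \<open>insert (Suc n) S\<close>.\<close>

definition slice_rank :: "nat \<Rightarrow> (nat set \<Rightarrow> nat) \<Rightarrow> nat \<Rightarrow> nat set \<Rightarrow> nat" where
  "slice_rank n f k S = min (f S) (f (insert (Suc n) S) - k)"

lemma insert_subset_Suc: "S \<subseteq> {1..n} \<Longrightarrow> insert (Suc n) S \<subseteq> {1..Suc n}"
  by auto

lemma atLeastAtMost_Suc: "insert (Suc n) {1..n} = {1..Suc n}"
  by auto

lemma le_rank_insert:
  assumes "rank_function (Suc n) f" "k \<le> f {Suc n}" "S \<subseteq> {1..n}"
  shows "k \<le> f (insert (Suc n) S)"
  using rank_functionD(2)[OF assms(1), of "{Suc n}" "insert (Suc n) S"] assms(2,3)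
    insert_subset_Suc[OF assms(3)] by simp

lemma rank_function_slice:
  assumes f: "rank_function (Suc n) f" and k: "k \<le> f {Suc n}"
  shows "rank_function n (slice_rank n f k)"
proof -
  note D = rank_functionD[OF f]
  have sub: "S \<subseteq> {1..Suc n}" if "S \<subseteq> {1..n}" for S using that by force
  show ?thesis
    unfolding rank_function_def
  proof (intro conjI allI impI)
    show "slice_rank n f k {} = 0" by (simp add: slice_rank_def D(1))
  next
    fix I J :: "nat set" assume IJ: "I \<subseteq> J" "J \<subseteq> {1..n}"
    have "f I \<le> f J" "f (insert (Suc n) I) \<le> f (insert (Suc n) J)"
      using IJ sub insert_subset_Suc by (auto intro!: D(2))
    then show "slice_rank n f k I \<le> slice_rank n f k J"
      unfolding slice_rank_def by linarith
  next
    fix I J :: "nat set" assume IJ: "I \<subseteq> {1..n}" "J \<subseteq> {1..n}"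
    let ?I = "insert (Suc n) I" and ?J = "insert (Suc n) J"
    have ni: "Suc n \<notin> I" "Suc n \<notin> J" using IJ by auto
    note s = IJ sub insert_subset_Suc
    \<comment> \<open>The four inequalities cover the four choices of the smaller term in the minima
      for \<open>I\<close> and \<open>J\<close>. A mixed choice bounds the union with
      \<open>Suc n\<close> together with the intersection without it.\<close>
    have 1: "f (I \<union> J) + f (I \<inter> J) \<le> f I + f J" using s by (intro D(3)) auto
    have 2: "f (?I \<union> ?J) + f (?I \<inter> ?J) \<le> f ?I + f ?J" using s by (intro D(3)) auto
    have 3: "f (?I \<union> J) + f (?I \<inter> J) \<le> f ?I + f J" using s by (intro D(3)) auto
    have 4: "f (I \<union> ?J) + f (I \<inter> ?J) \<le> f I + f ?J" using s by (intro D(3)) auto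
    have e: "?I \<union> ?J = insert (Suc n) (I \<union> J)" "?I \<inter> ?J = insert (Suc n) (I \<inter> J)"
      "?I \<union> J = insert (Suc n) (I \<union> J)" "I \<union> ?J = insert (Suc n) (I \<union> J)"
      "?I \<inter> J = I \<inter> J" "I \<inter> ?J = I \<inter> J" using ni by auto
    have "k \<le> f ?I" "k \<le> f ?J" "k \<le> f (insert (Suc n) (I \<union> J))" "k \<le> f (insert (Suc n) (I \<inter> J))"
      using IJ by (auto intro!: le_rank_insert[OF f k])
    then show "slice_rank n f k (I \<union> J) + slice_rank n f k (I \<inter> J)
        \<le> slice_rank n f k I + slice_rank n f k J"
      using 1 2 3 4 unfolding slice_rank_def e by linarith
  qed
qed

lemma slice_rank_total:
  assumes "f {1..Suc n} \<le> f {1..n} + k"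
  shows "slice_rank n f k {1..n} = f {1..Suc n} - k"
  using assms unfolding slice_rank_def atLeastAtMost_Suc by simp

text \<open>Complementation turns the minimum in \<open>slice_rank\<close> into a maximum and
  exchanges its two entries, since the complement of \<open>S\<close> in \<open>{1..n}\<close> omits
  \<open>Suc n\<close> as well.\<close>

lemma corank_slice:
  assumes f: "rank_function (Suc n) f" and k: "k \<le> f {Suc n}"
    and k': "f {1..Suc n} \<le> f {1..n} + k" and S: "S \<subseteq> {1..n}"
  shows "corank n (slice_rank n f k) S
    = max (corank (Suc n) f S) (corank (Suc n) f (insert (Suc n) S) - k)"
proof -
  have "insert (Suc n) ({1..n} - S) = {1..Suc n} - S" using S by auto
  moreover have "{1..n} - S = {1..Suc n} - insert (Suc n) S" by auto
  moreover have "k \<le> f (insert (Suc n) ({1..n} - S))" by (rule le_rank_insert[OF f k]) auto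
  ultimately show ?thesis
    unfolding corank_def slice_rank_total[OF k'] by (simp add: slice_rank_def)
qed

text \<open>A constraint on a subset of \<open>{1..Suc n}\<close> becomes one of the two entries of
  the minimum, according to whether the subset contains \<open>Suc n\<close>. The hypothesis on
  \<open>f {1..n} + k\<close> makes the total of the slice \<open>f {1..Suc n} - k\<close>.\<close>

lemma slice_mem_iff:
  assumes f: "rank_function (Suc n) f" and k: "k \<le> f {Suc n}"
    and k': "f {1..Suc n} \<le> f {1..n} + k"
  shows "a \<in> polymatroid n (slice_rank n f k) \<longleftrightarrow>
    a (Suc n) = 0 \<and> a(Suc n := int k) \<in> polymatroid (Suc n) f"
proof -
  let ?b = "a(Suc n := int k)"
  have sum_b: "sum ?b S = sum a S" if "Suc n \<notin> S" for S
    using that by (intro sum.cong) auto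
  have sum_b': "sum ?b (insert (Suc n) S) = sum a S + int k" if "S \<subseteq> {1..n}" for S
  proof -
    have "finite S" "Suc n \<notin> S" using that finite_subset by auto
    then show ?thesis using sum_b by simp
  qed
  have m: "k \<le> f {1..Suc n}"
    using le_rank_insert[OF f k, of "{1..n}"] unfolding atLeastAtMost_Suc by simp
  show ?thesis
  proof
    assume a: "a \<in> polymatroid n (slice_rank n f k)"
    note D = polymatroidD[OF a]
    have "sum ?b I \<le> int (f I)" if "I \<subseteq> {1..Suc n}" for I
    proof (cases "Suc n \<in> I")
      case False
      then have "I \<subseteq> {1..n}" using that by (force simp: le_Suc_eq)
      from D(3)[OF this] sum_b[OF False] show ?thesis
        by (simp add: slice_rank_def)
    next
      case True
      define S where "S = I - {Suc n}"
      have S: "I = insert (Suc n) S" "S \<subseteq> {1..n}"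
        using that True by (force simp: S_def le_Suc_eq)+
      have "sum a S \<le> int (f I - k)" using D(3)[OF S(2)] by (simp add: slice_rank_def S(1))
      then show ?thesis
        using sum_b'[OF S(2)] le_rank_insert[OF f k S(2)] unfolding S(1) by linarith
    qed
    moreover have "sum ?b {1..Suc n} = int (f {1..Suc n})"
      using sum_b'[of "{1..n}"] D(4) m slice_rank_total[OF k'] by (simp add: atLeastAtMost_Suc)
    ultimately show "a (Suc n) = 0 \<and> ?b \<in> polymatroid (Suc n) f"
      using D(1,2) unfolding polymatroid_def by auto
  next
    assume a: "a (Suc n) = 0 \<and> ?b \<in> polymatroid (Suc n) f"
    note D = polymatroidD[of ?b "Suc n" f, OF conjunct2[OF a]]
    have "0 \<le> a i" for i using D(1)[of i] a by (cases "i = Suc n") auto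
    moreover have "a i = 0" if "i \<notin> {1..n}" for i
      using D(2)[of i] a that by (cases "i = Suc n") auto
    moreover have "sum a I \<le> int (slice_rank n f k I)" if "I \<subseteq> {1..n}" for I
    proof -
      have "Suc n \<notin> I" "I \<subseteq> {1..Suc n}" using that by force+
      then have "sum a I \<le> int (f I)" using D(3) sum_b by metis
      moreover have "sum a I + int k \<le> int (f (insert (Suc n) I))"
        using D(3)[OF insert_subset_Suc[OF that]] sum_b'[OF that] by simp
      ultimately show ?thesis unfolding slice_rank_def by linarith
    qed
    moreover have "sum a {1..n} = int (slice_rank n f k {1..n})"
      using sum_b'[of "{1..n}"] D(4) m slice_rank_total[OF k'] by (simp add: atLeastAtMost_Suc)
    ultimately show "a \<in> polymatroid n (slice_rank n f k)"
      unfolding polymatroid_def by auto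
  qed
qed

text \<open>The inclusion-minimal tight set containing \<open>e\<close> supplies the element to exchange with \<open>e\<close>.\<close>

lemma exists_exchange:
  assumes f: "rank_function n f" and a: "a \<in> polymatroid n f"
    and e: "e \<in> {1..n}" and lt: "a e < int (f {e})"
  shows "\<exists>j\<in>{1..n}. j \<noteq> e \<and> a + std_basis e - std_basis j \<in> polymatroid n f"
proof -
  note D = polymatroidD[OF a]
  define tight where "tight T \<longleftrightarrow> T \<subseteq> {1..n} \<and> e \<in> T \<and> sum a T = int (f T)" for T
  \<comment> \<open>Submodularity uncrosses tight sets: neither the union nor the intersection can
    have slack.\<close>
  have inter: "tight (S \<inter> T)" if "tight S" "tight T" for S T
  proof -
    have fin: "finite S" "finite T" using that finite_subset unfolding tight_def by blast+
    have "sum a (S \<union> T) + sum a (S \<inter> T) = sum a S + sum a T"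
      using sum.union_inter[OF fin, of a] .
    moreover have "f (S \<union> T) + f (S \<inter> T) \<le> f S + f T"
      using rank_functionD(3)[OF f] that unfolding tight_def by blast
    moreover have "sum a (S \<union> T) \<le> int (f (S \<union> T))" "sum a (S \<inter> T) \<le> int (f (S \<inter> T))"
      using that by (auto simp: tight_def intro!: D(3))
    ultimately show ?thesis using that unfolding tight_def by auto
  qed
  have "tight {1..n}" using e D(4) by (simp add: tight_def)
  then obtain T where T: "tight T" and min: "\<And>S. tight S \<Longrightarrow> card T \<le> card S"
    using arg_min_nat_lemma[of tight "{1..n}" card] by blast
  have finT: "finite T" using T finite_subset unfolding tight_def by blast
  have least: "T \<subseteq> S" if "tight S" for S
  proof -
    have "card T \<le> card (T \<inter> S)" using min inter[OF T that] by blast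
    then have "T \<inter> S = T" using finT by (intro card_seteq) auto
    then show ?thesis by auto
  qed
  have "T \<noteq> {e}" using T lt unfolding tight_def by auto
  then obtain j where j: "j \<in> T" "j \<noteq> e" using T unfolding tight_def by auto
  have jn: "j \<in> {1..n}" using j T unfolding tight_def by auto
  \<comment> \<open>A zero entry could be dropped from \<open>T\<close> without losing tightness,
    against minimality.\<close>
  have aj: "a j \<ge> 1"
  proof (rule ccontr)
    assume "\<not> ?thesis"
    then have "a j = 0" using D(1)[of j] by simp
    then have s: "sum a (T - {j}) = sum a T"
      using finT j(1) by (simp add: sum_diff1)
    have "f (T - {j}) \<le> f T"
      using T by (intro rank_functionD(2)[OF f]) (auto simp: tight_def)
    moreover have "sum a (T - {j}) \<le> int (f (T - {j}))"
      using T by (intro D(3)) (auto simp: tight_def)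
    ultimately have "tight (T - {j})" using T j s unfolding tight_def by auto
    then show False using least j by blast
  qed
  let ?b = "a + std_basis e - std_basis j"
  have sum_b: "sum ?b S = sum a S + (if e \<in> S then 1 else 0) - (if j \<in> S then 1 else 0)"
    if "finite S" for S
    using that by (simp add: sum.distrib sum_subtractf std_basis_def)
  \<comment> \<open>Only sets with \<open>e\<close> but not \<open>j\<close> gain weight. They are
    not tight, as every tight set contains \<open>T\<close>.\<close>
  have "sum ?b I \<le> int (f I)" if I: "I \<subseteq> {1..n}" for I
  proof (cases "e \<in> I \<and> j \<notin> I")
    case True
    then have "\<not> tight I" using least j by blast
    then have "sum a I < int (f I)" using True I D(3)[OF I] by (auto simp: tight_def)
    then show ?thesis using True sum_b[OF finite_subset[OF I]] by simp
  next
    case False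
    then show ?thesis using D(3)[OF I] sum_b[OF finite_subset[OF I]] by auto
  qed
  moreover have "sum ?b {1..n} = int (f {1..n})"
    using D(4) e jn sum_b[of "{1..n}"] by simp
  moreover have "0 \<le> ?b i" for i using D(1)[of i] aj by (auto simp: std_basis_def)
  moreover have "?b i = 0" if "i \<notin> {1..n}" for i
    using D(2)[OF that] that e jn by (auto simp: std_basis_def)
  ultimately have "?b \<in> polymatroid n f" unfolding polymatroid_def by auto
  then show ?thesis using jn j(2) by blast
qed

text \<open>Activity of an index \<open>i\<close> up to \<open>n\<close> only involves moves with
  \<open>j < i\<close>, which fix the last coordinate and stay in the slice. For
  \<open>Suc n\<close> every other index is allowed, so by \<open>exists_exchange\<close> it is
  active only at the maximal value \<open>f {Suc n}\<close>.\<close>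

lemma Ext_act_slice:
  assumes f: "rank_function (Suc n) f" and k: "k \<le> f {Suc n}"
    and k': "f {1..Suc n} \<le> f {1..n} + k" and a: "a \<in> polymatroid n (slice_rank n f k)"
  shows "Ext_act (Suc n) (polymatroid (Suc n) f) (a(Suc n := int k)) =
    Ext_act n (polymatroid n (slice_rank n f k)) a \<union> (if k = f {Suc n} then {Suc n} else {})"
    (is "?L = ?R")
proof -
  let ?b = "a(Suc n := int k)" and ?P = "polymatroid (Suc n) f"
    and ?Q = "polymatroid n (slice_rank n f k)"
  have b: "?b \<in> ?P" and a0: "a (Suc n) = 0" using slice_mem_iff[OF f k k'] a by auto
  have step: "?b + std_basis i - std_basis j \<in> ?P \<longleftrightarrow> a + std_basis i - std_basis j \<in> ?Q"
    if "i \<in> {1..n}" "j \<in> {1..n}" for i j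
  proof -
    have "?b + std_basis i - std_basis j = (a + std_basis i - std_basis j)(Suc n := int k)"
      using that by (auto simp: fun_eq_iff std_basis_def)
    moreover have "(a + std_basis i - std_basis j) (Suc n) = 0"
      using that a0 by (auto simp: std_basis_def)
    ultimately show ?thesis using slice_mem_iff[OF f k k'] by simp
  qed
  have last: "Suc n \<in> ?L \<longleftrightarrow> k = f {Suc n}"
  proof
    assume act: "Suc n \<in> ?L"
    show "k = f {Suc n}"
    proof (rule ccontr)
      assume "k \<noteq> f {Suc n}"
      then have "?b (Suc n) < int (f {Suc n})" using k by simp
      then obtain j where "j \<in> {1..Suc n}" "j \<noteq> Suc n"
        "?b + std_basis (Suc n) - std_basis j \<in> ?P"
        using exists_exchange[OF f b, of "Suc n"] by auto
      then show False using act unfolding Ext_act_def by auto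
    qed
  next
    assume keq: "k = f {Suc n}"
    have "?b + std_basis (Suc n) - std_basis j \<notin> ?P" if "j < Suc n" for j
    proof
      assume "?b + std_basis (Suc n) - std_basis j \<in> ?P"
      from polymatroidD(3)[OF this, of "{Suc n}"] show False
        using keq that by (simp add: std_basis_def)
    qed
    then show "Suc n \<in> ?L" unfolding Ext_act_def by auto
  qed
  have "i \<in> ?L \<longleftrightarrow> i \<in> ?R" for i
  proof (cases "i = Suc n")
    case True
    moreover have "Suc n \<notin> Ext_act n ?Q a" by (simp add: Ext_act_def)
    ultimately show ?thesis using last by auto
  next
    case False
    show ?thesis
    proof (cases "i \<in> {1..n}")
      case True
      then have "i \<in> ?L \<longleftrightarrow> (\<forall>j\<in>{1..n}. j < i \<longrightarrow> ?b + std_basis i - std_basis j \<notin> ?P)"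
        unfolding Ext_act_def by auto
      also have "\<dots> \<longleftrightarrow> i \<in> Ext_act n ?Q a"
        using True step unfolding Ext_act_def by auto
      finally show ?thesis using False by auto
    next
      case False
      with \<open>i \<noteq> Suc n\<close> show ?thesis unfolding Ext_act_def by (auto split: if_splits)
    qed
  qed
  then show ?thesis by blast
qed

text \<open>The slice is parametrised by its first \<open>n\<close> coordinates. Outside the top
  slice the inactive last index contributes one extra factor \<open>monom 1 1\<close>.\<close>

lemma exterior_poly_slice:
  assumes f: "rank_function (Suc n) f" and k: "k \<le> f {Suc n}"
    and k': "f {1..Suc n} \<le> f {1..n} + k"
  shows "(\<Sum>a | a \<in> polymatroid (Suc n) f \<and> a (Suc n) = int k.
      monom 1 (Suc n - card (Ext_act (Suc n) (polymatroid (Suc n) f) a)) :: int poly)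
    = (if k = f {Suc n} then 1 else monom 1 1) * exterior_poly n (polymatroid n (slice_rank n f k))"
proof -
  let ?P = "polymatroid (Suc n) f" and ?Q = "polymatroid n (slice_rank n f k)"
  let ?h = "\<lambda>a. a(Suc n := int k)"
  have "bij_betw ?h ?Q {a. a \<in> ?P \<and> a (Suc n) = int k}"
  proof (rule bij_betw_imageI)
    show "inj_on ?h ?Q"
    proof (rule inj_onI)
      fix a b assume *: "a \<in> ?Q" "b \<in> ?Q" "?h a = ?h b"
      then have "a (Suc n) = b (Suc n)" using slice_mem_iff[OF f k k'] by auto
      then show "a = b" using *(3) by (metis fun_upd_triv fun_upd_upd)
    qed
    show "?h ` ?Q = {a. a \<in> ?P \<and> a (Suc n) = int k}"
    proof (intro equalityI subsetI)
      fix b assume b: "b \<in> {a. a \<in> ?P \<and> a (Suc n) = int k}"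
      then have "(b(Suc n := 0))(Suc n := int k) = b" by auto
      moreover from this b have "b(Suc n := 0) \<in> ?Q" by (subst slice_mem_iff[OF f k k']) auto
      ultimately show "b \<in> ?h ` ?Q" by (metis image_eqI)
    qed (use slice_mem_iff[OF f k k'] in auto)
  qed
  from sum.reindex_bij_betw[OF this, symmetric]
  have "(\<Sum>a | a \<in> ?P \<and> a (Suc n) = int k. monom 1 (Suc n - card (Ext_act (Suc n) ?P a)) :: int poly)
    = (\<Sum>a\<in>?Q. monom 1 (Suc n - card (Ext_act (Suc n) ?P (?h a))))" .
  also have "\<dots> = (\<Sum>a\<in>?Q. (if k = f {Suc n} then 1 else monom 1 1) *
      monom 1 (n - card (Ext_act n ?Q a)))"
  proof (rule sum.cong[OF refl])
    fix a assume a: "a \<in> ?Q"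
    have sub: "Ext_act n ?Q a \<subseteq> {1..n}" by (auto simp: Ext_act_def)
    have "card (Ext_act n ?Q a) \<le> n" using card_mono[OF _ sub] by simp
    moreover have "finite (Ext_act n ?Q a)" "Suc n \<notin> Ext_act n ?Q a"
      using sub finite_subset by auto
    ultimately show "(monom 1 (Suc n - card (Ext_act (Suc n) ?P (?h a))) :: int poly)
      = (if k = f {Suc n} then 1 else monom 1 1) * monom 1 (n - card (Ext_act n ?Q a))"
      unfolding Ext_act_slice[OF f k k' a]
      by (cases "k = f {Suc n}") (simp_all add: mult_monom Suc_diff_le)
  qed
  finally show ?thesis by (simp add: exterior_poly_def sum_distrib_left)
qed

lemma exterior_poly_recursion:
  assumes f: "rank_function (Suc n) f"
  shows "exterior_poly (Suc n) (polymatroid (Suc n) f) =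
    (\<Sum>k\<in>{f {1..Suc n} - f {1..n}..f {Suc n}}. (if k = f {Suc n} then 1 else monom 1 1) *
       exterior_poly n (polymatroid n (slice_rank n f k)))"
proof -
  let ?P = "polymatroid (Suc n) f" and ?K = "{f {1..Suc n} - f {1..n}..f {Suc n}}"
  \<comment> \<open>The last entry is at most \<open>f {Suc n}\<close>, and the other entries sum to
    at most \<open>f {1..n}\<close>, which bounds it from below.\<close>
  have img: "nat (a (Suc n)) \<in> ?K" if a: "a \<in> ?P" for a
  proof -
    note D = polymatroidD[OF a]
    have "sum a {1..Suc n} = a (Suc n) + sum a {1..n}" by simp
    moreover have "sum a {1..n} \<le> int (f {1..n})" by (rule D(3)) auto
    moreover have "a (Suc n) \<le> int (f {Suc n})" using D(3)[of "{Suc n}"] by simp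
    ultimately show ?thesis using D(4) D(1)[of "Suc n"] by auto
  qed
  have "exterior_poly (Suc n) ?P = (\<Sum>k\<in>?K. \<Sum>a | a \<in> ?P \<and> nat (a (Suc n)) = k.
      monom 1 (Suc n - card (Ext_act (Suc n) ?P a)))"
    unfolding exterior_poly_def
    using sum.group[OF finite_polymatroid, of ?K "\<lambda>a. nat (a (Suc n))" "Suc n" f
        "\<lambda>a. monom 1 (Suc n - card (Ext_act (Suc n) ?P a)) :: int poly"] img
    by (auto simp: image_subset_iff)
  also have "\<dots> = (\<Sum>k\<in>?K. \<Sum>a | a \<in> ?P \<and> a (Suc n) = int k.
      monom 1 (Suc n - card (Ext_act (Suc n) ?P a)))"
  proof (intro sum.cong refl Collect_cong conj_cong)
    show "nat (a (Suc n)) = k \<longleftrightarrow> a (Suc n) = int k" if "a \<in> ?P" for a k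
      using polymatroidD(1)[OF that, of "Suc n"] by auto
  qed
  also have "\<dots> = (\<Sum>k\<in>?K. (if k = f {Suc n} then 1 else monom 1 1) *
       exterior_poly n (polymatroid n (slice_rank n f k)))"
    by (intro sum.cong refl exterior_poly_slice[OF f]) auto
  finally show ?thesis .
qed

section \<open>The exterior polynomial modulo a power of the variable\<close>

lemma coeff_sum_monom_card:
  assumes "finite X"
  shows "coeff (\<Sum>C\<in>X. monom 1 (card C) :: int poly) i = int (card {C\<in>X. card C = i})"
proof -
  have "coeff (\<Sum>C\<in>X. monom 1 (card C) :: int poly) i = (\<Sum>C\<in>X. if card C = i then 1 else 0)"
    by (simp add: coeff_sum)
  also have "\<dots> = (\<Sum>C\<in>{C\<in>X. card C = i}. 1)"
    using assms by (intro sum.inter_filter[symmetric])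
  finally show ?thesis by simp
qed

lemma monom_dvd_sum_diff:
  assumes "finite X" "finite Y" "\<And>C. card C < N \<Longrightarrow> C \<in> X \<longleftrightarrow> C \<in> Y"
  shows "monom 1 N dvd (\<Sum>C\<in>X. monom 1 (card C) :: int poly) - (\<Sum>C\<in>Y. monom 1 (card C))"
  unfolding monom_1_dvd_iff'
proof (intro allI impI)
  fix i assume "i < N"
  then have "{C\<in>X. card C = i} = {C\<in>Y. card C = i}" using assms(3) by auto
  then show "coeff ((\<Sum>C\<in>X. monom 1 (card C) :: int poly) - (\<Sum>C\<in>Y. monom 1 (card C))) i = 0"
    unfolding coeff_diff coeff_sum_monom_card[OF assms(1)] coeff_sum_monom_card[OF assms(2)] by simp
qed

section \<open>Circuits with and without the last element, and circuits of slices\<close>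

definition circuit_poly :: "nat \<Rightarrow> (nat set \<Rightarrow> nat) \<Rightarrow> int poly" where
  "circuit_poly n f = 1 - (\<Sum>C\<in>circuits n f. monom 1 (card C))"

definition del_circuits :: "nat \<Rightarrow> (nat set \<Rightarrow> nat) \<Rightarrow> nat set set" where
  "del_circuits n f = {C \<in> circuits (Suc n) f. Suc n \<notin> C}"

text \<open>The condition \<open>S \<subseteq> {1..n}\<close> keeps \<open>Suc n\<close> out of
  \<open>S\<close>, so that adding it is injective and raises the size by one.\<close>

definition link_circuits :: "nat \<Rightarrow> (nat set \<Rightarrow> nat) \<Rightarrow> nat set set" where
  "link_circuits n f = {S. S \<subseteq> {1..n} \<and> insert (Suc n) S \<in> circuits (Suc n) f}"

lemma finite_del_circuits: "finite (del_circuits n f)"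
  using finite_circuits by (simp add: del_circuits_def)

lemma finite_link_circuits: "finite (link_circuits n f)"
  by (rule finite_subset[of _ "Pow {1..n}"]) (auto simp: link_circuits_def)

text \<open>A common member would be a circuit properly contained in the circuit obtained by adding
  \<open>Suc n\<close>.\<close>

lemma del_link_disjoint: "del_circuits n f \<inter> link_circuits n f = {}"
proof -
  have "S \<notin> link_circuits n f" if "S \<in> del_circuits n f" for S
  proof
    assume "S \<in> link_circuits n f"
    moreover have "S \<subset> insert (Suc n) S" using that by (auto simp: del_circuits_def)
    ultimately have "corank (Suc n) f S = 0" unfolding link_circuits_def circuits_def by blast
    then show False using that by (simp add: del_circuits_def circuits_def)
  qed
  then show ?thesis by blast
qed

lemma circuit_poly_split:
  "circuit_poly (Suc n) f = 1 - (\<Sum>C\<in>del_circuits n f. monom 1 (card C))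
     - monom 1 1 * (\<Sum>S\<in>link_circuits n f. monom 1 (card S))"
proof -
  let ?L = "insert (Suc n) ` link_circuits n f"
  have notin: "Suc n \<notin> S" if "S \<in> link_circuits n f" for S
    using that by (auto simp: link_circuits_def)
  have "circuits (Suc n) f = del_circuits n f \<union> ?L"
  proof (intro equalityI subsetI)
    fix C assume C: "C \<in> circuits (Suc n) f"
    show "C \<in> del_circuits n f \<union> ?L"
    proof (cases "Suc n \<in> C")
      case True
      then have "insert (Suc n) (C - {Suc n}) = C" by auto
      moreover have "C - {Suc n} \<subseteq> {1..n}"
        using C unfolding circuits_def by (force simp: le_Suc_eq)
      ultimately show ?thesis using C unfolding link_circuits_def by (smt (verit) UnI2 image_eqI mem_Collect_eq)
    qed (use C in \<open>auto simp: del_circuits_def\<close>)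
  qed (auto simp: del_circuits_def link_circuits_def)
  moreover have "del_circuits n f \<inter> ?L = {}" by (auto simp: del_circuits_def)
  moreover have "inj_on (insert (Suc n)) (link_circuits n f)"
    using notin by (meson inj_onI insert_ident)
  moreover have "card (insert (Suc n) S) = Suc (card S)" if "S \<in> link_circuits n f" for S
    using that notin[OF that] finite_subset by (subst card_insert_disjoint) (auto simp: link_circuits_def)
  ultimately have "(\<Sum>C\<in>circuits (Suc n) f. monom 1 (card C) :: int poly) =
      (\<Sum>C\<in>del_circuits n f. monom 1 (card C)) + (\<Sum>S\<in>link_circuits n f. monom 1 (Suc (card S)))"
    by (simp add: sum.union_disjoint finite_del_circuits finite_link_circuits sum.reindex)
  then show ?thesis by (simp add: circuit_poly_def sum_distrib_left mult_monom)
qed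

text \<open>Under the last hypothesis the maximum in \<open>corank_slice\<close> is its first entry
  on every subset of \<open>C\<close>. This hypothesis always holds for \<open>k = f {Suc n}\<close>
  and, when small sets have corank at most 1, for small \<open>C\<close> and every
  \<open>k > 0\<close>.\<close>

lemma circuits_slice_iff:
  assumes f: "rank_function (Suc n) f" and k: "k \<le> f {Suc n}"
    and k': "f {1..Suc n} \<le> f {1..n} + k"
    and eq: "\<And>T. T \<subseteq> C \<Longrightarrow> T \<subseteq> {1..n} \<Longrightarrow>
      corank (Suc n) f (insert (Suc n) T) \<le> corank (Suc n) f T + k"
  shows "C \<in> circuits n (slice_rank n f k) \<longleftrightarrow> C \<in> del_circuits n f"
proof (cases "C \<subseteq> {1..n}")
  case True
  then have ss: "T \<subseteq> {1..n}" if "T \<subseteq> C" for T using that by blast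
  have h: "corank n (slice_rank n f k) T = corank (Suc n) f T" if "T \<subseteq> C" for T
    using corank_slice[OF f k k' ss[OF that]] eq[OF that ss[OF that]] by simp
  have "C \<subseteq> {1..Suc n}" "Suc n \<notin> C" using True by force+
  then show ?thesis
    using h True unfolding circuits_def del_circuits_def by (auto simp: psubset_eq)
next
  case False
  then show ?thesis unfolding circuits_def del_circuits_def by (force simp: le_Suc_eq)
qed

text \<open>At \<open>k = 0\<close> the slice corank of \<open>T\<close> is the corank of
  \<open>insert (Suc n) T\<close>. In general only the minimal members of the union on the right
  would survive; the bound by 1 keeps a member of \<open>link_circuits\<close> from lying inside a
  circuit that avoids \<open>Suc n\<close>. The size bound \<open>N - 1\<close> leaves room for
  adding \<open>Suc n\<close>.\<close>

lemma circuits_slice_0_iff: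
  assumes f: "rank_function (Suc n) f" and k': "f {1..Suc n} \<le> f {1..n}"
    and N: "\<And>S. S \<subseteq> {1..Suc n} \<Longrightarrow> card S < N \<Longrightarrow> corank (Suc n) f S \<le> 1"
    and C: "card C < N - 1"
  shows "C \<in> circuits n (slice_rank n f 0) \<longleftrightarrow> C \<in> del_circuits n f \<union> link_circuits n f"
proof (cases "C \<subseteq> {1..n}")
  case True
  let ?e = "Suc n" and ?h = "corank (Suc n) f"
  have fin: "finite C" and ne: "?e \<notin> C" using True finite_subset by auto
  have h: "corank n (slice_rank n f 0) T = ?h (insert ?e T)" if "T \<subseteq> C" for T
    using corank_slice[OF f _ _ subset_trans[OF that True], of 0] k'
      corank_mono[OF f subset_insertI, of T ?e] by (simp add: max_absorb2)
  have c: "C \<in> circuits n (slice_rank n f 0) \<longleftrightarrow>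
      ?h (insert ?e C) > 0 \<and> (\<forall>T. T \<subset> C \<longrightarrow> ?h (insert ?e T) = 0)"
    using True h unfolding circuits_def by (auto simp: psubset_eq)
  have le1: "?h (insert ?e C) \<le> 1"
    using fin ne C insert_subset_Suc[OF True] by (intro N) auto
  show ?thesis
  proof
    assume "C \<in> circuits n (slice_rank n f 0)"
    then have pos: "?h (insert ?e C) > 0" and min: "\<And>T. T \<subset> C \<Longrightarrow> ?h (insert ?e T) = 0"
      using c by auto
    have min': "?h T = 0" if "T \<subset> C" for T
      using min[OF that] corank_mono[OF f, of T "insert ?e T"] by auto
    show "C \<in> del_circuits n f \<union> link_circuits n f"
    proof (cases "?h C = 0")
      case True': True
      have "?h T = 0" if "T \<subset> insert ?e C" for T
      proof (cases "?e \<in> T")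
        case True
        then have "T - {?e} \<subset> C" "insert ?e (T - {?e}) = T" using that ne by auto
        then show ?thesis using min by metis
      next
        case False
        then have "T \<subseteq> C" using that by auto
        then show ?thesis using corank_mono[OF f, of T C] True' by auto
      qed
      then have "C \<in> link_circuits n f"
        using True pos insert_subset_Suc[OF True] by (simp add: link_circuits_def circuits_def)
      then show ?thesis by simp
    next
      case False
      then have "C \<in> del_circuits n f"
        using True min' ne by (force simp: del_circuits_def circuits_def)
      then show ?thesis by simp
    qed
  next
    assume "C \<in> del_circuits n f \<union> link_circuits n f"
    then show "C \<in> circuits n (slice_rank n f 0)"
    proof
      assume "C \<in> link_circuits n f"
      then have pos: "?h (insert ?e C) > 0" and min: "\<And>T. T \<subset> insert ?e C \<Longrightarrow> ?h T = 0"
        unfolding link_circuits_def circuits_def by auto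
      have "?h (insert ?e T) = 0" if "T \<subset> C" for T
      proof (rule min)
        show "insert ?e T \<subset> insert ?e C"
        proof (rule psubsetI)
          show "insert ?e T \<subseteq> insert ?e C" using that by (intro insert_mono) simp
          have "?e \<notin> T" using that ne by (meson psubsetD)
          then show "insert ?e T \<noteq> insert ?e C" using that ne insert_ident by (metis psubset_eq)
        qed
      qed
      then show ?thesis unfolding c using pos by (intro conjI allI impI)
    next
      assume "C \<in> del_circuits n f"
      then have pos: "?h C > 0" and min: "\<And>T. T \<subset> C \<Longrightarrow> ?h T = 0"
        unfolding del_circuits_def circuits_def by auto
      have "?h (insert ?e T) = 0" if "T \<subset> C" for T
      proof -
        \<comment> \<open>If \<open>insert ?e T\<close> had positive corank, as \<open>C\<close>
          has, their union \<open>insert ?e C\<close> would have corank at least 2, since the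
          intersection \<open>T\<close> has corank 0.\<close>
        have "?h (insert ?e T) + ?h C \<le> ?h (insert ?e T \<union> C) + ?h (insert ?e T \<inter> C)"
          by (rule corank_supermodular[OF f])
        moreover have "insert ?e T \<union> C = insert ?e C" "insert ?e T \<inter> C = T"
          using psubset_imp_subset[OF that] ne by auto
        ultimately show ?thesis using pos min[OF that] le1 by simp
      qed
      moreover have "?h (insert ?e C) > 0"
        using pos corank_mono[OF f subset_insertI, of C ?e] by simp
      ultimately show ?thesis unfolding c by (intro conjI allI impI)
    qed
  qed
next
  case False
  then show ?thesis unfolding circuits_def del_circuits_def link_circuits_def by (force simp: le_Suc_eq)
qed

text \<open>The case in which the slice with last coordinate zero is empty.\<close>

lemma del_link_of_coloop:
  assumes f: "rank_function (Suc n) f"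
    and k': "\<not> f {1..Suc n} \<le> f {1..n}"
    and N: "\<And>S. S \<subseteq> {1..Suc n} \<Longrightarrow> card S < N \<Longrightarrow> corank (Suc n) f S \<le> 1"
    and C: "card C < N - 1"
  shows "C \<in> del_circuits n f \<union> link_circuits n f \<longleftrightarrow> C = {}"
proof -
  let ?e = "Suc n" and ?h = "corank (Suc n) f"
  have "{1..Suc n} - {Suc n} = {1..n}" by auto
  then have e1: "?h {?e} > 0" using k' by (simp add: corank_def)
  have "?h T = 0" if "T \<subset> {?e}" for T
  proof -
    have "T = {}" using that by auto
    then show ?thesis by simp
  qed
  then have "{} \<in> link_circuits n f"
    using e1 by (simp add: link_circuits_def circuits_def)
  moreover have "C = {}" if "C \<in> link_circuits n f"
  proof (rule ccontr)
    assume "C \<noteq> {}"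
    then have "{?e} \<subset> insert ?e C" using that by (auto simp: link_circuits_def)
    moreover have "?h T = 0" if "T \<subset> insert ?e C" for T
      using that \<open>C \<in> link_circuits n f\<close> unfolding link_circuits_def circuits_def by simp
    ultimately have "?h {?e} = 0" by metis
    then show False using e1 by simp
  qed
  moreover have "C \<notin> del_circuits n f"
  proof
    assume D: "C \<in> del_circuits n f"
    then have sub: "C \<subseteq> {1..Suc n}" and ne: "?e \<notin> C" and pos: "?h C > 0"
      by (auto simp: del_circuits_def circuits_def)
    \<comment> \<open>The positive coranks of \<open>C\<close> and \<open>{?e}\<close> would add up
      to at least 2 on the union, whose size is still below \<open>N\<close>.\<close>
    have "?h C + ?h {?e} \<le> ?h (C \<union> {?e}) + ?h (C \<inter> {?e})" by (rule corank_supermodular[OF f])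
    moreover have "?h (C \<union> {?e}) \<le> 1"
      using sub ne C finite_subset[OF sub] by (intro N) auto
    ultimately show False using pos e1 ne by simp
  qed
  ultimately show ?thesis by auto
qed

text \<open>\<open>N\<close> varies in the induction: a slice below the top is needed only modulo
  \<open>monom 1 (N - 1)\<close>, because its inactive last index supplies another factor
  \<open>monom 1 1\<close>.\<close>

theorem exterior_poly_mod:
  assumes "rank_function n f"
    and "\<And>S. S \<subseteq> {1..n} \<Longrightarrow> card S < N \<Longrightarrow> corank n f S \<le> 1"
  shows "monom 1 N dvd
    (1 - monom 1 1) ^ f {1..n} * exterior_poly n (polymatroid n f) - circuit_poly n f"
  using assms
proof (induction n arbitrary: f N)
  case 0
  have f0: "f {} = 0" using rank_functionD(1)[OF 0(1)] .
  then have "polymatroid 0 f = {\<lambda>_. 0}"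
    by (auto simp: polymatroid_def)
  then have "exterior_poly 0 (polymatroid 0 f) = 1"
    by (simp add: exterior_poly_def)
  moreover have "circuits 0 f = {}" by (auto simp: circuits_def)
  ultimately show ?case using f0 by (simp add: circuit_poly_def)
next
  case (Suc n)
  note f = Suc.prems(1) and le1 = Suc.prems(2)
  let ?h = "corank (Suc n) f" and ?e = "Suc n"
  define m where "m = f {1..Suc n}"
  define t where "t = f {Suc n}"
  define c where "c = m - f {1..n}"
  define Y :: "int poly" where "Y = monom 1 1"
  define Z :: "int poly" where "Z = 1 - Y"
  \<comment> \<open>\<open>D k\<close> pairs slice \<open>k\<close> with the power of
    \<open>Z\<close> given by its own total \<open>m - k\<close>. \<open>G\<close> puts 0 for the
    empty slices below \<open>c\<close>, and \<open>R k\<close> is the expected residue of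
    \<open>G k\<close> for \<open>k < t\<close>.\<close>
  define D where "D k = Z ^ (m - k) * exterior_poly n (polymatroid n (slice_rank n f k))" for k
  define G where "G k = (if k < c then 0 else D k)" for k
  define A :: "int poly" where "A = (\<Sum>C\<in>del_circuits n f. monom 1 (card C))"
  define B :: "int poly" where "B = (\<Sum>C\<in>link_circuits n f. monom 1 (card C))"
  define R where "R k = (1 - A) - (if k = 0 then B else 0)" for k :: nat
  have tm: "t \<le> m" unfolding t_def m_def by (rule rank_functionD(2)[OF f]) auto
  have ct: "c \<le> t"
    using rank_insert_le[OF f, of "{1..n}" "Suc n"]
    unfolding c_def t_def m_def atLeastAtMost_Suc by auto
  have K: "k \<le> f {Suc n}" "f {1..Suc n} \<le> f {1..n} + k" if "c \<le> k" "k \<le> t" for k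
    using that unfolding c_def t_def m_def by auto
  have total: "slice_rank n f k {1..n} = m - k" if "c \<le> k" "k \<le> t" for k
    unfolding m_def by (rule slice_rank_total[OF K(2)[OF that]])
  have subS: "S \<subseteq> {1..Suc n}" if "S \<subseteq> {1..n}" for S using that by force
  have card_ins: "card (insert ?e S) = Suc (card S)" if "S \<subseteq> {1..n}" for S
    using that finite_subset[OF that] by (subst card_insert_disjoint) auto
  have ins_le: "?h (insert ?e S) \<le> ?h S + t" for S
    unfolding t_def by (rule corank_insert_le[OF f]) simp
  have split: "circuit_poly (Suc n) f = 1 - A - Y * B"
    unfolding circuit_poly_split A_def B_def Y_def ..

  have top: "monom 1 N dvd D t - (1 - A)"
  proof -
    note Kt = K[OF ct order_refl]
    \<comment> \<open>By \<open>ins_le\<close> the maximum in \<open>corank_slice\<close> is the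
      corank of \<open>S\<close> itself, so the full precision \<open>N\<close> is kept.\<close>
    have "corank n (slice_rank n f t) S \<le> 1" if "S \<subseteq> {1..n}" "card S < N" for S
      using corank_slice[OF f Kt that(1)] le1[OF subS[OF that(1)] that(2)] ins_le[of S] by simp
    from Suc.IH[OF rank_function_slice[OF f Kt(1)] this]
    have "monom 1 N dvd D t - circuit_poly n (slice_rank n f t)"
      by (simp only: D_def Z_def Y_def total[OF ct order_refl])
    moreover have "circuits n (slice_rank n f t) = del_circuits n f"
      using circuits_slice_iff[OF f Kt] ins_le by blast
    ultimately show ?thesis by (simp add: circuit_poly_def A_def)
  qed

  have below: "monom 1 (N - 1) dvd G k - R k" if kt: "k < t" for k
  proof (cases "k < c")
    case True
    show ?thesis
    proof (cases "k = 0")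
      case k0: True
      \<comment> \<open>The slice at 0 is empty, so \<open>R 0\<close> itself has to vanish modulo
        \<open>monom 1 (N - 1)\<close>. It does because the empty set is the only small member of
        the two families.\<close>
      have "monom 1 (N - 1) dvd (\<Sum>C\<in>{{} :: nat set}. monom 1 (card C) :: int poly)
          - (\<Sum>C\<in>del_circuits n f \<union> link_circuits n f. monom 1 (card C))"
      proof (rule monom_dvd_sum_diff)
        have c: "\<not> f {1..Suc n} \<le> f {1..n}" using True by (simp add: c_def m_def)
        show "C \<in> {{}} \<longleftrightarrow> C \<in> del_circuits n f \<union> link_circuits n f" if "card C < N - 1" for C :: "nat set"
          using del_link_of_coloop[OF f c le1 that] by simp
      qed (simp_all add: finite_del_circuits finite_link_circuits)
      also have "(\<Sum>C\<in>{{} :: nat set}. monom 1 (card C) :: int poly)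
          - (\<Sum>C\<in>del_circuits n f \<union> link_circuits n f. monom 1 (card C)) = 1 - A - B"
        by (simp add: sum.union_disjoint finite_del_circuits finite_link_circuits
            del_link_disjoint A_def B_def)
      finally have "monom 1 (N - 1) dvd - (1 - A - B)" by (simp only: dvd_minus_iff)
      then show ?thesis using True k0 by (simp add: G_def R_def)
    next
      case False
      \<comment> \<open>Here \<open>c\<close> is the corank of \<open>{?e}\<close>. A value of at
        least 2 forces \<open>N\<close> to be at most 1, and the divisor is 1.\<close>
      then have "2 \<le> c" using True by simp
      moreover have "{1..Suc n} - {Suc n} = {1..n}" by auto
      ultimately have "2 \<le> ?h {?e}" by (simp add: c_def m_def corank_def)
      then have "\<not> card {?e} < N" using le1[of "{?e}"] by auto
      then show ?thesis by simp
    qed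
  next
    case False
    then have ck: "c \<le> k" and kt': "k \<le> t" using kt by auto
    note Kk = K[OF ck kt']
    have h1: "?h (insert ?e S) \<le> 1" if "S \<subseteq> {1..n}" "card S < N - 1" for S
      using that card_ins[OF that(1)] by (intro le1 insert_subset_Suc) auto
    have "corank n (slice_rank n f k) S \<le> 1" if "S \<subseteq> {1..n}" "card S < N - 1" for S
      using corank_slice[OF f Kk that(1)] le1[OF subS[OF that(1)]] h1[OF that] that(2) by simp
    from Suc.IH[OF rank_function_slice[OF f Kk(1)] this]
    have 1: "monom 1 (N - 1) dvd D k - circuit_poly n (slice_rank n f k)"
      by (simp only: D_def Z_def Y_def total[OF ck kt'])
    have 2: "monom 1 (N - 1) dvd circuit_poly n (slice_rank n f k) - R k"
    proof (cases "k = 0")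
      case True
      have "monom 1 (N - 1) dvd
          (\<Sum>C\<in>del_circuits n f \<union> link_circuits n f. monom 1 (card C) :: int poly)
          - (\<Sum>C\<in>circuits n (slice_rank n f k). monom 1 (card C))"
      proof (rule monom_dvd_sum_diff)
        have k': "f {1..Suc n} \<le> f {1..n}" using Kk(2) True by simp
        show "C \<in> del_circuits n f \<union> link_circuits n f \<longleftrightarrow> C \<in> circuits n (slice_rank n f k)"
          if "card C < N - 1" for C
          using circuits_slice_0_iff[OF f k' le1 that] True by simp
      qed (simp_all add: finite_del_circuits finite_link_circuits finite_circuits)
      also have "(\<Sum>C\<in>del_circuits n f \<union> link_circuits n f. monom 1 (card C) :: int poly)
          - (\<Sum>C\<in>circuits n (slice_rank n f k). monom 1 (card C))
          = circuit_poly n (slice_rank n f k) - R k"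
        using True by (simp add: sum.union_disjoint finite_del_circuits finite_link_circuits
            del_link_disjoint A_def B_def R_def circuit_poly_def)
      finally show ?thesis .
    next
      case k0: False
      have "monom 1 (N - 1) dvd (\<Sum>C\<in>del_circuits n f. monom 1 (card C) :: int poly)
          - (\<Sum>C\<in>circuits n (slice_rank n f k). monom 1 (card C))"
      proof (rule monom_dvd_sum_diff)
        fix C :: "nat set" assume C: "card C < N - 1"
        show "C \<in> del_circuits n f \<longleftrightarrow> C \<in> circuits n (slice_rank n f k)"
        proof (cases "C \<subseteq> {1..n}")
          case True
          \<comment> \<open>On small sets the left side is at most 1, and \<open>k\<close> is
            positive.\<close>
          have "?h (insert ?e T) \<le> ?h T + k" if T: "T \<subseteq> C" "T \<subseteq> {1..n}" for T
          proof -
            have "card T \<le> card C" using card_mono[OF finite_subset[OF True] T(1)] by simp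
            then show ?thesis using h1[OF T(2)] C k0 by simp
          qed
          from circuits_slice_iff[OF f Kk this] show ?thesis by simp
        next
          case False
          then show ?thesis unfolding circuits_def del_circuits_def by (force simp: le_Suc_eq)
        qed
      qed (simp_all add: finite_del_circuits finite_circuits)
      then show ?thesis using k0 by (simp add: A_def R_def circuit_poly_def)
    qed
    show ?thesis using dvd_add[OF 1 2] False by (simp add: G_def)
  qed

  \<comment> \<open>For \<open>t = 0\<close> the sum over \<open>k < t\<close> has no term
    \<open>k = 0\<close> to carry the correction \<open>B\<close>, so \<open>B\<close> must
    vanish.\<close>
  have B0: "B = 0" if "t = 0"
  proof -
    have "link_circuits n f = {}"
    proof -
      have "S \<notin> link_circuits n f" for S
      proof
        assume S: "S \<in> link_circuits n f"
        then have "S \<subset> insert ?e S" by (auto simp: link_circuits_def)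
        moreover have "?h T = 0" if "T \<subset> insert ?e S" for T
          using that S unfolding link_circuits_def circuits_def by simp
        ultimately have "?h S = 0" by metis
        moreover have "?h (insert ?e S) > 0" using S by (simp add: link_circuits_def circuits_def)
        ultimately show False using ins_le[of S] that by simp
      qed
      then show ?thesis by blast
    qed
    then show ?thesis by (simp add: B_def)
  qed
  have geometric: "Y * (\<Sum>k<t. Z ^ k) = 1 - Z ^ t"
    using one_diff_power_eq[of Z t] by (simp add: Z_def)
  have "(\<Sum>k<t. Z ^ k * R k) = (1 - A) * (\<Sum>k<t. Z ^ k) - B"
  proof (cases "t = 0")
    case False
    have "(\<Sum>k<t. Z ^ k * R k) = (\<Sum>k<t. (1 - A) * Z ^ k - (if k = 0 then B else 0))"
      by (intro sum.cong) (auto simp: R_def algebra_simps)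
    also have "\<dots> = (1 - A) * (\<Sum>k<t. Z ^ k) - B"
      using False by (simp add: sum_subtractf sum_distrib_left)
    finally show ?thesis .
  qed (simp add: B0)
  moreover have "Y * ((1 - A) * S - B) = (1 - A) * (Y * S) - Y * B" for S
    by (simp add: algebra_simps)
  ultimately have "Y * (\<Sum>k<t. Z ^ k * R k) = (1 - A) * (1 - Z ^ t) - Y * B"
    by (simp only: geometric)
  \<comment> \<open>The target now has the form of the recursion, so that the two can be compared
    slice by slice.\<close>
  then have expected: "circuit_poly (Suc n) f = Z ^ t * (1 - A) + Y * (\<Sum>k<t. Z ^ k * R k)"
    unfolding split by (simp add: algebra_simps)

  have "Z ^ m * exterior_poly (Suc n) (polymatroid (Suc n) f)
      = (\<Sum>k\<in>{c..t}. (if k = t then 1 else Y) * (Z ^ k * D k))"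
    unfolding exterior_poly_recursion[OF f] sum_distrib_left
      m_def[symmetric] c_def[symmetric] t_def[symmetric] Y_def[symmetric]
  proof (rule sum.cong[OF refl])
    fix k assume "k \<in> {c..t}"
    then have "Z ^ m = Z ^ k * Z ^ (m - k)" using tm by (simp flip: power_add)
    then show "Z ^ m * ((if k = t then 1 else Y) * exterior_poly n (polymatroid n (slice_rank n f k)))
        = (if k = t then 1 else Y) * (Z ^ k * D k)"
      by (simp add: D_def)
  qed
  also have "{c..t} = insert t {c..<t}" using ct by auto
  also have "(\<Sum>k\<in>insert t {c..<t}. (if k = t then 1 else Y) * (Z ^ k * D k))
      = Z ^ t * D t + (\<Sum>k\<in>{c..<t}. Y * (Z ^ k * D k))"
    by simp
  also have "(\<Sum>k\<in>{c..<t}. Y * (Z ^ k * D k)) = (\<Sum>k<t. Y * (Z ^ k * G k))"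
    by (rule sum.mono_neutral_cong_left) (auto simp: G_def)
  also have "Z ^ t * D t + (\<Sum>k<t. Y * (Z ^ k * G k)) - circuit_poly (Suc n) f
      = Z ^ t * (D t - (1 - A)) + Y * (\<Sum>k<t. Z ^ k * (G k - R k))"
    unfolding expected by (simp add: right_diff_distrib sum_subtractf sum_distrib_left)
  finally have eq: "Z ^ m * exterior_poly (Suc n) (polymatroid (Suc n) f) - circuit_poly (Suc n) f
      = Z ^ t * (D t - (1 - A)) + Y * (\<Sum>k<t. Z ^ k * (G k - R k))"
    by simp
  have "monom 1 N dvd Y * (\<Sum>k<t. Z ^ k * (G k - R k))"
  proof (cases "N = 0")
    case False
    then have "monom 1 N = Y * monom 1 (N - 1)" by (simp add: Y_def mult_monom)
    then show ?thesis
      using below by (auto intro!: mult_dvd_mono dvd_sum dvd_mult)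
  qed simp
  then have "monom 1 N dvd Z ^ t * (D t - (1 - A)) + Y * (\<Sum>k<t. Z ^ k * (G k - R k))"
    using top by (metis dvd_add dvd_mult)
  then show ?case by (simp only: eq m_def[symmetric] Z_def[symmetric] Y_def[symmetric])
qed

section \<open>Unimodality\<close>

lemma corank_le_1:
  assumes "S \<subseteq> {1..n}" "enat (card S) < r2 n f"
  shows "corank n f S \<le> 1"
proof (rule ccontr)
  assume "\<not> ?thesis"
  then have "int (f ({1..n} - S)) \<le> int (f {1..n}) - 2" unfolding corank_def by simp
  moreover have "card S \<le> n" using card_mono[OF _ assms(1)] by simp
  then have "n - card ({1..n} - S) = card S"
    using card_Diff_subset[OF finite_subset[OF assms(1)] assms(1)] by simp
  ultimately have "enat (card S) \<in>
      {enat (n - card F) |F. F \<subseteq> {1..n} \<and> int (f F) \<le> int (f {1..n}) - 2}"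
    by (intro CollectI exI[of _ "{1..n} - S"]) simp
  then have "r2 n f \<le> enat (card S)" unfolding r2_def by (rule Inf_lower)
  then show False using assms(2) by simp
qed

lemma coeff_exterior_poly:
  assumes f: "rank_function n f" and i: "enat i < r2 n f"
  shows "coeff ((1 - monom 1 1) ^ f {1..n} * exterior_poly n (polymatroid n f)) i
    = (if i = 0 then 1 else 0) - int (card {C \<in> circuits n f. card C = i})"
proof -
  \<comment> \<open>\<open>r2\<close> may be infinite, so the congruence is applied with the finite
    bound \<open>Suc i\<close>, for one coefficient at a time.\<close>
  have "corank n f S \<le> 1" if "S \<subseteq> {1..n}" "card S < Suc i" for S
  proof (rule corank_le_1[OF that(1)])
    have "enat (card S) \<le> enat i" using that(2) by simp
    then show "enat (card S) < r2 n f" using i by (rule le_less_trans)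
  qed
  from exterior_poly_mod[OF f this, of "Suc i"]
  have "coeff ((1 - monom 1 1) ^ f {1..n} * exterior_poly n (polymatroid n f)) i
      = coeff (circuit_poly n f) i"
    by (simp add: monom_1_dvd_iff')
  also have "\<dots> = (if i = 0 then 1 else 0) - int (card {C \<in> circuits n f. card C = i})"
    by (simp add: circuit_poly_def coeff_sum_monom_card[OF finite_circuits])
  finally show ?thesis .
qed

section \<open>Coefficient sequences with at most one change of sign\<close>

definition sign_change_below :: "enat \<Rightarrow> int poly \<Rightarrow> bool" where
  "sign_change_below N p \<longleftrightarrow>
     (\<exists>k. \<forall>i. enat i < N \<longrightarrow> (i < k \<longrightarrow> 0 \<le> coeff p i) \<and> (k \<le> i \<longrightarrow> coeff p i \<le> 0))"

lemma coeff_one_minus_monom_mult: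
  fixes p :: "int poly"
  shows "coeff ((1 - monom 1 1) * p) 0 = coeff p 0"
    and "coeff ((1 - monom 1 1) * p) (Suc i) = coeff p (Suc i) - coeff p i"
  by (simp_all add: left_diff_distrib coeff_monom_mult)

text \<open>A partial sum of the coefficients of \<open>(1 - y) p\<close> increases up to the sign change and decreases
  afterwards, so once it is nonpositive it remains so.\<close>

lemma sign_change_below_mult:
  assumes "sign_change_below N ((1 - monom 1 1) * p)"
  shows "sign_change_below N p"
proof -
  obtain k where pos: "\<And>i. enat i < N \<Longrightarrow> i < k \<Longrightarrow> 0 \<le> coeff ((1 - monom 1 1) * p) i"
    and neg: "\<And>i. enat i < N \<Longrightarrow> k \<le> i \<Longrightarrow> coeff ((1 - monom 1 1) * p) i \<le> 0"
    using assms unfolding sign_change_below_def by blast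
  have less: "enat i < N" if "enat (Suc i) < N" for i
    using that by (meson enat_ord_simps(2) lessI less_trans)
  \<comment> \<open>The new change of sign is at the first nonpositive coefficient from
    \<open>k\<close> on, which exists as the coefficients vanish beyond the degree.\<close>
  define k' where "k' = (LEAST j. k \<le> j \<and> coeff p j \<le> 0)"
  have "k \<le> max k (Suc (degree p)) \<and> coeff p (max k (Suc (degree p))) \<le> 0"
    using coeff_eq_0[of p "max k (Suc (degree p))"] by simp
  then have k': "k \<le> k'" "coeff p k' \<le> 0"
    unfolding k'_def by (rule LeastI2; simp)+
  have "0 \<le> coeff p i" if "enat i < N" "i < k" for i
    using that
  proof (induction i)
    case 0
    then show ?case using pos[of 0] by (simp add: coeff_one_minus_monom_mult[unfolded One_nat_def])
  next
    case (Suc i)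
    then show ?case using pos[of "Suc i"] less by (simp add: coeff_one_minus_monom_mult[unfolded One_nat_def])
  qed
  moreover have "0 \<le> coeff p i" if "k \<le> i" "i < k'" for i
    using not_less_Least[of i "\<lambda>j. k \<le> j \<and> coeff p j \<le> 0"] that unfolding k'_def by auto
  moreover have "coeff p i \<le> 0" if "k' \<le> i" "enat i < N" for i
    using that
  proof (induction i rule: dec_induct)
    case base
    then show ?case using k'(2) by simp
  next
    case (step i)
    have "coeff p (Suc i) \<le> coeff p i"
      using neg[of "Suc i"] step k'(1) by (simp add: coeff_one_minus_monom_mult[unfolded One_nat_def])
    then show ?case using step less by fastforce
  qed
  ultimately show ?thesis
    unfolding sign_change_below_def by (intro exI[of _ k']) (metis not_le)
qed

lemma sign_change_below_power_mult:
  "sign_change_below N ((1 - monom 1 1) ^ d * p) \<Longrightarrow> sign_change_below N p"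
proof (induction d)
  case (Suc d)
  then show ?case unfolding power_Suc mult.assoc by (blast dest: sign_change_below_mult)
qed simp

lemma unimodal_below_of_sign_change:
  assumes "sign_change_below N ((1 - monom 1 1) * p)"
  shows "unimodal_below N (\<lambda>i. real_of_int (coeff p i))"
proof -
  obtain k where k: "\<And>i. enat i < N \<Longrightarrow> (i < k \<longrightarrow> 0 \<le> coeff ((1 - monom 1 1) * p) i) \<and>
      (k \<le> i \<longrightarrow> coeff ((1 - monom 1 1) * p) i \<le> 0)"
    using assms unfolding sign_change_below_def by blast
  show ?thesis unfolding unimodal_below_def
  \<comment> \<open>The difference of entries \<open>i\<close> and \<open>Suc i\<close> is
    coefficient \<open>Suc i\<close> of the product, which shifts the change of sign by one. For
    \<open>k = 0\<close> the integer witness is -1.\<close>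
  proof (intro exI[of _ "int k - 1"] allI impI)
    fix i assume "enat (Suc i) < N"
    from k[OF this] show "(int i < int k - 1 \<longrightarrow> real_of_int (coeff p i) \<le> real_of_int (coeff p (Suc i))) \<and>
        (int k - 1 < int i \<longrightarrow> real_of_int (coeff p (Suc i)) \<le> real_of_int (coeff p i))"
      by (auto simp: coeff_one_minus_monom_mult[unfolded One_nat_def])
  qed
qed

text \<open>Of the \<open>f {1..n}\<close> factors \<open>1 - monom 1 1\<close>, all but one are
  stripped by partial summation, and the last is kept for the differences. If there is no factor at
  all, there are no circuits either and the coefficients are read off directly.\<close>

theorem unimodal_exterior_poly:
  assumes f: "rank_function n f"
  shows "unimodal_below (r2 n f) (\<lambda>i. real_of_int (coeff (exterior_poly n (polymatroid n f)) i))"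
    (is "unimodal_below _ (\<lambda>i. real_of_int (coeff ?X i))")
proof (cases "f {1..n}")
  case 0
  then have "circuits n f = {}" by (auto simp: circuits_def corank_def)
  then have coeff: "coeff ?X i = (if i = 0 then 1 else 0)" if "enat i < r2 n f" for i
    using coeff_exterior_poly[OF f that] 0 by simp
  show ?thesis unfolding unimodal_below_def
  \<comment> \<open>Below \<open>r2\<close> the sequence is 1, 0, 0, and so on: nonincreasing from
    the start.\<close>
  proof (intro exI[of _ "-1"] allI impI)
    fix i assume i: "enat (Suc i) < r2 n f"
    have "enat i < enat (Suc i)" by simp
    then have "enat i < r2 n f" using i by (rule less_trans)
    then show "(int i < - 1 \<longrightarrow> real_of_int (coeff ?X i) \<le> real_of_int (coeff ?X (Suc i))) \<and>
        (- 1 < int i \<longrightarrow> real_of_int (coeff ?X (Suc i)) \<le> real_of_int (coeff ?X i))"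
      using coeff i by simp
  qed
next
  case (Suc d)
  have nonempty: "card C \<noteq> 0" if "C \<in> circuits n f" for C
    using that finite_subset[of C "{1..n}"] by (auto simp: circuits_def)
  have "sign_change_below (r2 n f) ((1 - monom 1 1) ^ f {1..n} * ?X)"
    unfolding sign_change_below_def
  \<comment> \<open>No circuit is empty, so the constant coefficient is 1; the others are negated
    counts of circuits.\<close>
  proof (intro exI[of _ 1] allI impI)
    fix i assume i: "enat i < r2 n f"
    have "card {C \<in> circuits n f. card C = 0} = 0" using nonempty by (simp add: card_eq_0_iff)
    then show "(i < 1 \<longrightarrow> 0 \<le> coeff ((1 - monom 1 1) ^ f {1..n} * ?X) i) \<and>
      (1 \<le> i \<longrightarrow> coeff ((1 - monom 1 1) ^ f {1..n} * ?X) i \<le> 0)"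
      unfolding coeff_exterior_poly[OF f i] by (cases "i = 0") simp_all
  qed
  then have "sign_change_below (r2 n f) ((1 - monom 1 1) ^ d * ((1 - monom 1 1) * ?X))"
    unfolding Suc power_Suc2 mult.assoc .
  then show ?thesis
    by (rule unimodal_below_of_sign_change[OF sign_change_below_power_mult])
qed

section \<open>Reflection\<close>

text \<open>This bound keeps the subtraction in \<open>dual_rank\<close> from truncating and makes
  \<open>dual_rank\<close> monotone.\<close>

lemma rank_Un_le_sum:
  assumes f: "rank_function n f" and "A \<subseteq> {1..n}" "B \<subseteq> {1..n}"
  shows "f (A \<union> B) \<le> f A + (\<Sum>i\<in>B. f {i})"
proof -
  have "finite B" using assms(3) finite_subset by blast
  then show ?thesis using assms(3)
  proof (induction B)
    case (insert b B)
    have "f (A \<union> insert b B) \<le> f (A \<union> B) + f {b}"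
      using rank_insert_le[OF f, of "A \<union> B" b] insert.prems assms(2) by simp
    then show ?case using insert by simp
  qed simp
qed

text \<open>The rank function of the reflected polymatroid \<open>{c - a | a \<in> P}\<close> with \<open>c i = f {i}\<close>.\<close>

definition dual_rank :: "nat \<Rightarrow> (nat set \<Rightarrow> nat) \<Rightarrow> nat set \<Rightarrow> nat" where
  "dual_rank n f S = (\<Sum>i\<in>S. f {i}) + f ({1..n} - S) - f {1..n}"

text \<open>The value 0 outside \<open>{1..n}\<close> keeps reflected vectors among the vectors of
  length \<open>n\<close>.\<close>

definition singleton_ranks :: "nat \<Rightarrow> (nat set \<Rightarrow> nat) \<Rightarrow> nat \<Rightarrow> int" where
  "singleton_ranks n f i = (if i \<in> {1..n} then int (f {i}) else 0)"

lemma int_dual_rank: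
  assumes f: "rank_function n f" and S: "S \<subseteq> {1..n}"
  shows "int (dual_rank n f S) = (\<Sum>i\<in>S. int (f {i})) + int (f ({1..n} - S)) - int (f {1..n})"
proof -
  have "f (({1..n} - S) \<union> S) \<le> f ({1..n} - S) + (\<Sum>i\<in>S. f {i})"
    by (rule rank_Un_le_sum[OF f _ S]) auto
  moreover have "({1..n} - S) \<union> S = {1..n}" using S by auto
  ultimately show ?thesis unfolding dual_rank_def by simp
qed

lemma rank_function_dual:
  assumes f: "rank_function n f"
  shows "rank_function n (dual_rank n f)"
  unfolding rank_function_def
proof (intro conjI allI impI)
  show "dual_rank n f {} = 0" by (simp add: dual_rank_def)
next
  fix I J :: "nat set" assume IJ: "I \<subseteq> J" "J \<subseteq> {1..n}"
  have "f (({1..n} - J) \<union> (J - I)) \<le> f ({1..n} - J) + (\<Sum>i\<in>J - I. f {i})"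
    using IJ by (intro rank_Un_le_sum[OF f]) auto
  moreover have "({1..n} - J) \<union> (J - I) = {1..n} - I" using IJ by auto
  moreover have "(\<Sum>i\<in>J. f {i}) = (\<Sum>i\<in>J - I. f {i}) + (\<Sum>i\<in>I. f {i})"
    using IJ finite_subset[OF IJ(2)] by (intro sum.subset_diff) auto
  ultimately show "dual_rank n f I \<le> dual_rank n f J" unfolding dual_rank_def by simp
next
  fix I J :: "nat set" assume IJ: "I \<subseteq> {1..n}" "J \<subseteq> {1..n}"
  have "f (({1..n} - I) \<union> ({1..n} - J)) + f (({1..n} - I) \<inter> ({1..n} - J))
      \<le> f ({1..n} - I) + f ({1..n} - J)"
    by (rule rank_functionD(3)[OF f]) auto
  moreover have "({1..n} - I) \<union> ({1..n} - J) = {1..n} - I \<inter> J"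
    "({1..n} - I) \<inter> ({1..n} - J) = {1..n} - (I \<union> J)" by auto
  moreover have "(\<Sum>i\<in>I \<union> J. int (f {i})) + (\<Sum>i\<in>I \<inter> J. int (f {i}))
      = (\<Sum>i\<in>I. int (f {i})) + (\<Sum>i\<in>J. int (f {i}))"
    using IJ finite_subset by (intro sum.union_inter) auto
  moreover have "I \<union> J \<subseteq> {1..n}" "I \<inter> J \<subseteq> {1..n}" using IJ by auto
  ultimately have "int (dual_rank n f (I \<union> J)) + int (dual_rank n f (I \<inter> J))
      \<le> int (dual_rank n f I) + int (dual_rank n f J)"
    using IJ by (simp add: int_dual_rank[OF f])
  then show "dual_rank n f (I \<union> J) + dual_rank n f (I \<inter> J) \<le> dual_rank n f I + dual_rank n f J"
    by linarith
qed

text \<open>Once the totals are fixed, the constraint on \<open>I\<close> for the reflection is the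
  constraint on the complement of \<open>I\<close> for \<open>a\<close>. Nonnegativity on either
  side comes from the singleton constraints on the other.\<close>

lemma dual_mem_iff:
  assumes f: "rank_function n f"
  shows "singleton_ranks n f - a \<in> polymatroid n (dual_rank n f) \<longleftrightarrow> a \<in> polymatroid n f"
proof -
  let ?c = "singleton_ranks n f" and ?g = "dual_rank n f"
  let ?b = "?c - a"
  have c_sum: "sum ?b I = (\<Sum>i\<in>I. int (f {i})) - sum a I" if "I \<subseteq> {1..n}" for I
  proof -
    have "sum ?c I = (\<Sum>i\<in>I. int (f {i}))"
      using that by (intro sum.cong) (auto simp: singleton_ranks_def)
    then show ?thesis by (simp add: sum_subtractf)
  qed
  have total: "sum ?b {1..n} = int (?g {1..n}) \<longleftrightarrow> sum a {1..n} = int (f {1..n})"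
    using rank_functionD(1)[OF f] by (simp only: c_sum int_dual_rank[OF f] order_refl) simp
  have ineq: "sum ?b I \<le> int (?g I) \<longleftrightarrow> sum a ({1..n} - I) \<le> int (f ({1..n} - I))"
    if "I \<subseteq> {1..n}" "sum a {1..n} = int (f {1..n})" for I
  proof -
    have "sum a {1..n} = sum a ({1..n} - I) + sum a I"
      using that by (intro sum.subset_diff) auto
    then show ?thesis using that by (simp only: c_sum int_dual_rank[OF f]) linarith
  qed
  have outside: "?b i = 0 \<longleftrightarrow> a i = 0" if "i \<notin> {1..n}" for i
    using that by (auto simp: singleton_ranks_def)
  have compl: "{1..n} - ({1..n} - I) = I" if "I \<subseteq> {1..n}" for I
    using that by auto
  show ?thesis
  proof
    assume b: "?b \<in> polymatroid n ?g"
    note D = polymatroidD[OF b]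
    have tot: "sum a {1..n} = int (f {1..n})" using D(4) total by simp
    have "0 \<le> a i" if i: "i \<in> {1..n}" for i
    proof -
      have "?b i \<le> int (?g {i})" using D(3)[of "{i}"] i by simp
      moreover have "f ({1..n} - {i}) \<le> f {1..n}" by (rule rank_functionD(2)[OF f]) auto
      ultimately show ?thesis
        using int_dual_rank[OF f, of "{i}"] i by (simp add: singleton_ranks_def)
    qed
    moreover have "sum a I \<le> int (f I)" if I: "I \<subseteq> {1..n}" for I
      using ineq[of "{1..n} - I"] D(3)[of "{1..n} - I"] tot compl[OF I] by simp
    ultimately show "a \<in> polymatroid n f"
      using D(2) outside tot unfolding polymatroid_def by auto
  next
    assume a: "a \<in> polymatroid n f"
    note D = polymatroidD[OF a]
    have "0 \<le> ?b i" if i: "i \<in> {1..n}" for i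
      using D(3)[of "{i}"] i by (simp add: singleton_ranks_def)
    moreover have "sum ?b I \<le> int (?g I)" if I: "I \<subseteq> {1..n}" for I
      using ineq[OF I D(4)] D(3)[of "{1..n} - I"] by auto
    moreover have "?b i = 0" if "i \<notin> {1..n}" for i
      using outside[OF that] D(2)[OF that] by simp
    ultimately show "?b \<in> polymatroid n ?g"
      using D(4) total unfolding polymatroid_def by auto
  qed
qed

text \<open>Reflection reverses signs, so adding \<open>std_basis i\<close> and removing
  \<open>std_basis j\<close> becomes the opposite move, while the order of the indices is
  unchanged.\<close>

lemma exterior_poly_dual:
  assumes f: "rank_function n f"
  shows "exterior_poly n (polymatroid n (dual_rank n f)) = interior_poly n (polymatroid n f)"
proof -
  let ?c = "singleton_ranks n f" and ?P = "polymatroid n f" and ?Q = "polymatroid n (dual_rank n f)"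
  have "bij_betw (\<lambda>a. ?c - a) ?P ?Q"
  proof (rule bij_betw_byWitness[where f' = "\<lambda>b. ?c - b"])
    have "?c - b \<in> ?P" if "b \<in> ?Q" for b
      using dual_mem_iff[OF f, of "?c - b"] that by simp
    then show "(\<lambda>b. ?c - b) ` ?Q \<subseteq> ?P" by blast
  qed (auto simp: dual_mem_iff[OF f])
  from sum.reindex_bij_betw[OF this, of "\<lambda>b. monom 1 (n - card (Ext_act n ?Q b)) :: int poly"]
  have "exterior_poly n ?Q = (\<Sum>a\<in>?P. monom 1 (n - card (Ext_act n ?Q (?c - a))))"
    by (simp add: exterior_poly_def)
  also have "\<dots> = (\<Sum>a\<in>?P. monom 1 (n - card (Int_act n ?P a)))"
  proof (rule sum.cong[OF refl])
    fix a
    have "?c - a + std_basis i - std_basis j \<in> ?Q \<longleftrightarrow> a - std_basis i + std_basis j \<in> ?P" for i j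
    proof -
      have "?c - a + std_basis i - std_basis j = ?c - (a - std_basis i + std_basis j)"
        by (simp add: algebra_simps)
      then show ?thesis by (simp only: dual_mem_iff[OF f])
    qed
    then have "Ext_act n ?Q (?c - a) = Int_act n ?P a"
      unfolding Ext_act_def Int_act_def by simp
    then show "(monom 1 (n - card (Ext_act n ?Q (?c - a))) :: int poly)
      = monom 1 (n - card (Int_act n ?P a))" by simp
  qed
  finally show ?thesis by (simp add: interior_poly_def)
qed

text \<open>The amount by which \<open>dual_rank\<close> drops from \<open>{1..n}\<close> to
  \<open>{1..n} - F\<close> equals the excess of the sum of singleton ranks over \<open>f F\<close>,
  so complements match the two families.\<close>

lemma r2_dual:
  assumes f: "rank_function n f"
  shows "r2 n (dual_rank n f) = r2' n f"
proof -
  let ?g = "dual_rank n f" and ?s = "\<lambda>F. \<Sum>i\<in>F. int (f {i})"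
  have key: "int (?g ({1..n} - F)) \<le> int (?g {1..n}) - 2 \<longleftrightarrow> ?s F - int (f F) \<ge> 2"
    "n - card ({1..n} - F) = card F" if F: "F \<subseteq> {1..n}" for F
  proof -
    have "{1..n} - ({1..n} - F) = F" using F by auto
    moreover have "?s {1..n} = ?s ({1..n} - F) + ?s F" using F by (intro sum.subset_diff) auto
    ultimately have "int (?g ({1..n} - F)) = ?s {1..n} - ?s F + int (f F) - int (f {1..n})"
      using int_dual_rank[OF f, of "{1..n} - F"] by simp
    moreover have "int (?g {1..n}) = ?s {1..n} - int (f {1..n})"
      using int_dual_rank[OF f, of "{1..n}"] rank_functionD(1)[OF f] by simp
    ultimately show "int (?g ({1..n} - F)) \<le> int (?g {1..n}) - 2 \<longleftrightarrow> ?s F - int (f F) \<ge> 2" by linarith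
    have "card F \<le> n" using card_mono[OF _ F] by simp
    then show "n - card ({1..n} - F) = card F"
      using card_Diff_subset[OF finite_subset[OF F] F] by simp
  qed
  have "{enat (n - card F) |F. F \<subseteq> {1..n} \<and> int (?g F) \<le> int (?g {1..n}) - 2}
      = {enat (card F) |F. F \<subseteq> {1..n} \<and> ?s F - int (f F) \<ge> 2}" (is "?L = ?R")
  proof (intro equalityI subsetI)
    fix x assume "x \<in> ?L"
    then obtain F where F: "F \<subseteq> {1..n}" "int (?g F) \<le> int (?g {1..n}) - 2" "x = enat (n - card F)"
      by blast
    let ?F = "{1..n} - F"
    have sub: "?F \<subseteq> {1..n}" by auto
    have "{1..n} - ?F = F" using F(1) by auto
    then have "?s ?F - int (f ?F) \<ge> 2" "x = enat (card ?F)" using key[OF sub] F by simp_all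
    then show "x \<in> ?R" using sub by blast
  next
    fix x assume "x \<in> ?R"
    then obtain F where F: "F \<subseteq> {1..n}" "?s F - int (f F) \<ge> 2" "x = enat (card F)"
      by blast
    have "int (?g ({1..n} - F)) \<le> int (?g {1..n}) - 2" "x = enat (n - card ({1..n} - F))"
      using key[OF F(1)] F by simp_all
    then show "x \<in> ?L" by blast
  qed
  then show ?thesis unfolding r2_def r2'_def by simp
qed

theorem theorem4p2:
  fixes n :: nat and f :: "nat set \<Rightarrow> nat" and P :: "(nat \<Rightarrow> int) set"
  assumes "n \<ge> 1"
    and "rank_function n f"
    and "P = polymatroid n f"
  shows
    "unimodal_below (r2 n f) (\<lambda>i. real_of_int (coeff (exterior_poly n P) i)) \<and>
    unimodal_below (r2' n f) (\<lambda>i. real_of_int (coeff (interior_poly n P) i))"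
  using unimodal_exterior_poly[OF assms(2)]
    unimodal_exterior_poly[OF rank_function_dual[OF assms(2)]]
  by (simp only: assms(3) r2_dual[OF assms(2)] exterior_poly_dual[OF assms(2)] simp_thms)

end
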